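(* Let $m \geq 1$ and $r \geq 0$ be integers, and for integers $k \geq 0$ and $n \geq 1$ put $$S_{k}^{r,m}(n) = \sum_{j=1}^{n} \bigl( r + (j-1) m \bigr)^k .$$ Then for any integers $k \geq 0$ and $n \geq 1$, $$S_{k}^{r,m}(n) = (-1)^{k+1} \frac{m^k}{k+1} \sum_{t=1}^{k+1} \left( V_{k,t}\!\left(n-1+\frac{r}{m}\right) - V_{k,t}\!\left(\frac{r}{m}-1 \right) \right) \frac{1}{t},$$ where $V_{k,t}(x)$ is the polynomial $$V_{k,t}(x) = \sum_{i=t}^{k+1} (-1)^i\, i!\, \left\{ {k+1 \atop i} \right\} \binom{x+i-t}{i+1-t}.$$
   Context: $\left\{ {k \atop i} \right\}$ denotes the Stirling number of the second kind (the number of partitions of a $k$-element set into $i$ nonempty blocks). For a real number $y$ and an integer $p \geq 0$, $\binom{y}{p} = \frac{y(y-1)\cdots(y-p+1)}{p!}$, so each $V_{k,t}(x)$ is a polynomial in $x$ and may be evaluated at rational arguments. The convention $0^0 = 1$ is used (relevant when $k = 0$ and $r = 0$). *)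

theory Defs
  imports Complex_Main "HOL-Combinatorics.Stirling"
begin

text \<open>Powers of an arithmetic progression. The index satisfies \<open>j \<ge> 1\<close>, so the subtraction
  on natural numbers does not truncate, and \<open>0 ^ 0 = 1\<close> as usual.\<close>

definition power_sum_AP :: "nat \<Rightarrow> nat \<Rightarrow> nat \<Rightarrow> nat \<Rightarrow> nat" where
  "power_sum_AP r m k n = (\<Sum>j=1..n. (r + (j - 1) * m) ^ k)"

text \<open>Here \<open>Stirling\<close> is the Stirling number of the second kind. Both natural-number
  subtractions are exact because \<open>t \<le> i\<close> holds for every index \<open>i\<close>.\<close>

definition V :: "nat \<Rightarrow> nat \<Rightarrow> real \<Rightarrow> real" where
  "V k t x = (\<Sum>i=t..k+1. (-1) ^ i * fact i * real (Stirling (k + 1) i)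
                * ((x + real (i - t)) gchoose (i + 1 - t)))"

end

theory Submission
  imports Defs
begin

text \<open>
  Put \<open>F x = (\<Sum>t=1..k+1. V k t x / t)\<close>. The right-hand side is, up to the factor in front,
  \<open>F\<close> at \<open>n - 1 + r/m\<close> minus \<open>F\<close> at \<open>r/m - 1\<close>, so the identity telescopes once it is known that
  \<open>F x - F (x - 1) = (-1) ^ (k+1) * (k+1) * x ^ k\<close>; the terms \<open>r + (j-1) m = m (r/m + j - 1)\<close>
  of the progression are exactly \<open>m\<close> times the points \<open>x\<close> that are passed on the way.

  Write \<open>R i x\<close> for \<open>pochhammer x i / fact i\<close>. By Pascal's rule, \<open>F x - F (x - 1)\<close> is the sum of
  \<open>(-1) ^ i * i! * Stirling (k+1) i * R (i-t) x / t\<close> over \<open>1 \<le> t \<le> i \<le> k+1\<close>. The generating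
  function of the \<open>R i x\<close> is \<open>(1 - z) powr (-x)\<close>, and that of the \<open>1/t\<close> is \<open>- ln (1 - z)\<close>; their
  product is the \<open>x\<close>-derivative of the first. Hence the sum over \<open>t\<close> is \<open>R i\<close> differentiated
  (lemma \<open>pochhammer_div_fact_has_derivative\<close>). What remains is the derivative of
  \<open>\<Sum>i. Stirling (k+1) i * (-1) ^ i * pochhammer x i\<close>, which equals \<open>(- x) ^ (k+1)\<close> because Stirling
  numbers of the second kind convert powers into falling factorials (lemma
  \<open>Stirling_pochhammer_sum\<close>).
\<close>

text \<open>This is the expansion of \<open>y ^ n\<close> in falling factorials at \<open>y = - x\<close>: the falling factorial of
  \<open>- x\<close> is \<open>(-1) ^ i * pochhammer x i\<close>.\<close>

lemma Stirling_pochhammer_sum: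
  fixes x :: "'a::comm_ring_1"
  shows "(\<Sum>i\<le>n. of_nat (Stirling n i) * ((-1) ^ i * pochhammer x i)) = (- x) ^ n"
proof (induction n)
  case 0
  show ?case by simp
next
  case (Suc n)
  let ?q = "\<lambda>i. (-1) ^ i * pochhammer x i"
  let ?S = "\<lambda>n i. of_nat (Stirling n i) :: 'a"
  have q_step: "- x * ?q i = ?q (Suc i) + of_nat i * ?q i" for i
    by (simp add: pochhammer_Suc algebra_simps)
  have shift: "(\<Sum>i\<le>n. of_nat (Suc i) * ?S n (Suc i) * ?q (Suc i)) = (\<Sum>i\<le>n. of_nat i * ?S n i * ?q i)"
  proof -
    have "(\<Sum>i\<le>n. of_nat i * ?S n i * ?q i) = (\<Sum>i\<le>Suc n. of_nat i * ?S n i * ?q i)"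
      by simp
    also have "\<dots> = (\<Sum>i\<le>n. of_nat (Suc i) * ?S n (Suc i) * ?q (Suc i))"
      by (subst sum.atMost_Suc_shift) simp
    finally show ?thesis by simp
  qed
  have "(\<Sum>i\<le>Suc n. ?S (Suc n) i * ?q i) = (\<Sum>i\<le>n. ?S (Suc n) (Suc i) * ?q (Suc i))"
    by (subst sum.atMost_Suc_shift) simp
  also have "\<dots> = (\<Sum>i\<le>n. of_nat (Suc i) * ?S n (Suc i) * ?q (Suc i) + ?S n i * ?q (Suc i))"
    by (intro sum.cong refl) (simp only: Stirling.simps of_nat_add of_nat_mult distrib_right)
  also have "\<dots> = (\<Sum>i\<le>n. of_nat i * ?S n i * ?q i) + (\<Sum>i\<le>n. ?S n i * ?q (Suc i))"
    by (simp only: sum.distrib shift)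
  also have "\<dots> = (\<Sum>i\<le>n. ?S n i * (?q (Suc i) + of_nat i * ?q i))"
    by (simp only: sum.distrib [symmetric]) (intro sum.cong refl, simp add: algebra_simps)
  also have "\<dots> = - x * (\<Sum>i\<le>n. ?S n i * ?q i)"
    by (simp only: q_step [symmetric] sum_distrib_left mult.left_commute)
  finally show ?case by (simp only: Suc.IH power_Suc)
qed

text \<open>Comparing coefficients of \<open>z ^ i\<close> in \<open>d/dx (1 - z) powr (-x) = - ln (1 - z) * (1 - z) powr (-x)\<close>
  gives this formula. The proof avoids series: both sides satisfy the recurrence obtained by
  differentiating \<open>(i + 1) R (i+1) x = (x + i) R i x\<close>, where \<open>R i x = pochhammer x i / fact i\<close>.\<close>

lemma pochhammer_div_fact_has_derivative:
  fixes x :: "'a::real_normed_field"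
  shows "((\<lambda>x. pochhammer x i / fact i) has_field_derivative
           (\<Sum>t=1..i. pochhammer x (i - t) / fact (i - t) / of_nat t)) (at x)"
proof (induction i)
  case 0
  show ?case by simp
next
  case (Suc i)
  define R where "R j = pochhammer x j / fact j" for j
  define E where "E j = (\<Sum>t=1..j. R (j - t) / of_nat t)" for j
  have R_rec: "of_nat (Suc j) * R (Suc j) = (x + of_nat j) * R j" for j
    unfolding R_def pochhammer_Suc fact_Suc
    by (simp add: field_simps del: of_nat_Suc)
  have E_rec: "of_nat (Suc i) * E (Suc i) = R i + (x + of_nat i) * E i"
  proof -
    \<comment> \<open>Splitting the factor as \<open>i + 1 = (i + 1 - t) + t\<close> lets the recurrence act on \<open>R (i + 1 - t)\<close>.\<close>
    have "of_nat (Suc i) * E (Suc i) =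
        (\<Sum>t=1..Suc i. of_nat (Suc i - t) * R (Suc i - t) / of_nat t + R (Suc i - t))"
      unfolding E_def sum_distrib_left
      by (intro sum.cong refl) (auto simp: of_nat_diff field_simps simp del: of_nat_Suc)
    also have "\<dots> = (\<Sum>t=1..i. of_nat (Suc i - t) * R (Suc i - t) / of_nat t)
                    + (\<Sum>t=1..Suc i. R (Suc i - t))"
      by (simp add: sum.distrib)
    also have "(\<Sum>t=1..i. of_nat (Suc i - t) * R (Suc i - t) / of_nat t)
                 = (\<Sum>t=1..i. (x + of_nat i) * (R (i - t) / of_nat t) - R (i - t))"
    proof (intro sum.cong refl)
      fix t assume t: "t \<in> {1..i}"
      then have "of_nat (Suc i - t) * R (Suc i - t) = (x + of_nat i - of_nat t) * R (i - t)"
        using R_rec [of "i - t"] by (simp add: Suc_diff_le of_nat_diff algebra_simps)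
      then show "of_nat (Suc i - t) * R (Suc i - t) / of_nat t
                   = (x + of_nat i) * (R (i - t) / of_nat t) - R (i - t)"
        using t by (simp add: field_simps)
    qed
    also have "\<dots> = (x + of_nat i) * E i - (\<Sum>t=1..i. R (i - t))"
      by (simp add: E_def sum_subtractf sum_distrib_left)
    also have "(\<Sum>t=1..Suc i. R (Suc i - t)) = R i + (\<Sum>t=1..i. R (i - t))"
      unfolding One_nat_def sum.atLeast1_atMost_eq sum.lessThan_Suc_shift by simp
    finally show ?thesis by simp
  qed
  define f :: "'a \<Rightarrow> 'a" where "f = (\<lambda>y. pochhammer y i / fact i)"
  have "(f has_field_derivative E i) (at x)"
    using Suc.IH by (simp only: f_def E_def R_def)
  then have "((\<lambda>y. (y + of_nat i) * f y / of_nat (Suc i)) has_field_derivative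
               (f x + (x + of_nat i) * E i) / of_nat (Suc i)) (at x)"
    by (intro DERIV_cdivide) (auto intro!: derivative_eq_intros simp: algebra_simps)
  also have "f x = R i"
    by (simp add: f_def R_def)
  also have "(\<lambda>y. (y + of_nat i) * f y / of_nat (Suc i)) = (\<lambda>y. pochhammer y (Suc i) / fact (Suc i))"
    by (simp add: f_def pochhammer_Suc fact_Suc mult_ac del: of_nat_Suc)
  also have "(R i + (x + of_nat i) * E i) / of_nat (Suc i) = E (Suc i)"
    using E_rec by (simp add: field_simps del: of_nat_Suc)
  finally show ?case unfolding E_def R_def .
qed

text \<open>Pascal's rule lowers the binomial coefficients in \<open>V\<close>; the upper argument of the lowered
  coefficient is such that it becomes a quotient \<open>pochhammer x (i - t) / fact (i - t)\<close>.\<close>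

lemma V_diff:
  "V k t x - V k t (x - 1) =
     (\<Sum>i=t..k+1. (-1) ^ i * fact i * real (Stirling (k + 1) i)
                    * (pochhammer x (i - t) / fact (i - t)))"
proof -
  have pascal: "((x + real (i - t)) gchoose (i + 1 - t)) - ((x - 1 + real (i - t)) gchoose (i + 1 - t))
                  = pochhammer x (i - t) / fact (i - t)" if "t \<le> i" for i
  proof -
    have "x + real (i - t) = (x - 1 + real (i - t)) + 1" by simp
    then show ?thesis
      using that gbinomial_Suc_Suc [of "x - 1 + real (i - t)" "i - t"]
      by (simp add: Suc_diff_le gbinomial_pochhammer')
  qed
  show ?thesis
    unfolding V_def sum_subtractf [symmetric] right_diff_distrib [symmetric]
    by (rule sum.cong [OF refl], subst pascal) auto
qed

text \<open>After exchanging the sums, the left-hand side is a linear combination of derivatives of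
  \<open>pochhammer y i / fact i\<close> at \<open>x\<close>. The same combination of the functions themselves is
  \<open>(- y) ^ (k + 1)\<close>, so uniqueness of derivatives yields the value.\<close>

lemma weighted_V_sum_diff:
  "(\<Sum>t=1..k+1. (V k t x - V k t (x - 1)) * (1 / real t)) = (-1) ^ (k + 1) * real (k + 1) * x ^ k"
proof -
  define c where "c i = (-1) ^ i * fact i * real (Stirling (k + 1) i)" for i
  define R where "R i y = pochhammer y i / fact i" for i and y :: real
  have "(\<Sum>t=1..k+1. (V k t x - V k t (x - 1)) * (1 / real t))
          = (\<Sum>t=1..k+1. \<Sum>i=t..k+1. c i * (R (i - t) x / real t))"
    unfolding V_diff c_def R_def sum_distrib_right by (intro sum.cong refl) simp
  also have "\<dots> = (\<Sum>i=1..k+1. \<Sum>t=1..i. c i * (R (i - t) x / real t))"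
    by (subst sum.Sigma, simp, simp, subst sum.Sigma, simp, simp)
      (rule sum.reindex_bij_witness [of _ "\<lambda>(i, t). (t, i)" "\<lambda>(t, i). (i, t)"]; auto)
  also have "\<dots> = (\<Sum>i\<le>k+1. c i * (\<Sum>t=1..i. R (i - t) x / real t))"
    \<comment> \<open>The added term \<open>i = 0\<close> contains an empty sum.\<close>
    unfolding sum_distrib_left by (intro sum.mono_neutral_left) auto
  finally have expand: "(\<Sum>t=1..k+1. (V k t x - V k t (x - 1)) * (1 / real t))
      = (\<Sum>i\<le>k+1. c i * (\<Sum>t=1..i. R (i - t) x / real t))" .
  have "((\<lambda>y. \<Sum>i\<le>k+1. c i * R i y) has_field_derivative
           (\<Sum>i\<le>k+1. c i * (\<Sum>t=1..i. R (i - t) x / real t))) (at x)"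
    unfolding R_def
    by (intro DERIV_sum DERIV_cmult pochhammer_div_fact_has_derivative)
  also have "(\<lambda>y. \<Sum>i\<le>k+1. c i * R i y) = (\<lambda>y. (- y) ^ (k + 1))"
  proof
    fix y
    show "(\<Sum>i\<le>k+1. c i * R i y) = (- y) ^ (k + 1)"
      unfolding Stirling_pochhammer_sum [of "k + 1" y, symmetric] c_def R_def
      by (intro sum.cong refl) simp
  qed
  finally have "((\<lambda>y. (- y) ^ (k + 1)) has_field_derivative
      (\<Sum>i\<le>k+1. c i * (\<Sum>t=1..i. R (i - t) x / real t))) (at x)" .
  moreover have "((\<lambda>y. (- y) ^ (k + 1)) has_field_derivative (-1) ^ (k + 1) * real (k + 1) * x ^ k) (at x)"
    using DERIV_power_Suc [OF DERIV_minus [OF DERIV_ident], of k x UNIV]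
    by (simp add: power_minus [of x] algebra_simps)
  ultimately show ?thesis
    unfolding expand by (rule DERIV_unique)
qed

theorem theorem8:
  fixes m r k n :: nat
  assumes "m \<ge> 1" and "n \<ge> 1"
  shows "real (power_sum_AP r m k n) =
    (-1) ^ (k + 1) * (real m ^ k / real (k + 1)) *
      (\<Sum>t=1..k+1. (V k t (real n - 1 + real r / real m) - V k t (real r / real m - 1))
                      * (1 / real t))"
proof -
  define a where "a = real r / real m"
  define F where "F x = (\<Sum>t=1..k+1. V k t x * (1 / real t))" for x
  have F_diff: "F x - F y = (\<Sum>t=1..k+1. (V k t x - V k t y) * (1 / real t))" for x y
    by (simp only: F_def sum_subtractf [symmetric] left_diff_distrib)
  have F_step: "F x - F (x - 1) = (-1) ^ (k + 1) * real (k + 1) * x ^ k" for x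
    unfolding F_diff by (rule weighted_V_sum_diff)
  have telescope: "F (real n - 1 + a) - F (a - 1)
      = (\<Sum>j<n. (-1) ^ (k + 1) * real (k + 1) * (a + real j) ^ k)" for n
  proof -
    have "(\<Sum>j<n. F (a + real j) - F (a + real j - 1)) = F (real n - 1 + a) - F (a - 1)"
      using sum_lessThan_telescope [of "\<lambda>j. F (a + real j - 1)" n]
      by (simp add: algebra_simps)
    then show ?thesis by (simp only: F_step)
  qed
  have "real (power_sum_AP r m k n) = (\<Sum>j<n. (real r + real j * real m) ^ k)"
    unfolding power_sum_AP_def
    by (simp add: sum.atLeast1_atMost_eq)
  also have "\<dots> = real m ^ k * (\<Sum>j<n. (a + real j) ^ k)"
  proof -
    have "real r + real j * real m = real m * (a + real j)" for j
      using \<open>m \<ge> 1\<close> by (simp add: a_def field_simps)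
    then show ?thesis
      by (simp only: power_mult_distrib sum_distrib_left)
  qed
  also have "\<dots> = (-1) ^ (k + 1) * (real m ^ k / real (k + 1)) * (F (real n - 1 + a) - F (a - 1))"
  proof -
    have "(-1 :: real) ^ (k + 1) * (-1) ^ (k + 1) = 1"
      by (simp add: power_mult_distrib [symmetric])
    then show ?thesis
      unfolding telescope sum_distrib_left [symmetric] by (simp add: field_simps)
  qed
  finally show ?thesis
    unfolding F_diff a_def .
qed

end
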